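(* Let $(X,\|\cdot\|)$ be a finite-dimensional real normed space whose norm is strictly convex, and let $K\subseteq X$ be a convex body. Then the metric projection onto $K$ is unique for every point $x\in X$; that is, for every $x\in X$ there is exactly one point $p\in K$ with $\|x-p\|=\inf\{\|x-y\|:y\in K\}$.
   Context: A convex body is a compact convex set with non-empty interior. A norm is strictly convex if the boundary of its unit ball contains no (non-degenerate) line segment. A metric projection of $x$ onto $K$ is a point $p\in K$ with $\|x-p\|=\inf\{\|x-y\|:y\in K\}$. *)

theory Defs
  imports "HOL-Analysis.Analysis"
begin

definition finite_dimensional :: "'a::real_vector itself \<Rightarrow> bool" where
  "finite_dimensional _ \<longleftrightarrow> (\<exists>B::'a set. finite B \<and> span B = UNIV)"

definition strictly_convex_norm :: "'a::real_normed_vector itself \<Rightarrow> bool" where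
  "strictly_convex_norm _ \<longleftrightarrow>
     \<not> (\<exists>a b::'a. a \<noteq> b \<and> closed_segment a b \<subseteq> frontier (cball 0 1))"

definition convex_body :: "'a::real_normed_vector set \<Rightarrow> bool" where
  "convex_body K \<longleftrightarrow> compact K \<and> convex K \<and> interior K \<noteq> {}"

text \<open>The infimum below is taken in the reals, where it is only meaningful for nonempty \<open>K\<close>.\<close>

definition is_metric_projection :: "'a::real_normed_vector set \<Rightarrow> 'a \<Rightarrow> 'a \<Rightarrow> bool" where
  "is_metric_projection K x p \<longleftrightarrow> p \<in> K \<and> norm (x - p) = (INF y\<in>K. norm (x - y))"

end

theory Submission
  imports Defs
begin

text \<open>A nearest point exists by compactness. If \<open>p \<noteq> q\<close> were both nearest to \<open>x\<close>, at
  distance \<open>d > 0\<close>, then every point of the segment from \<open>p\<close> to \<open>q\<close> would lie in \<open>K\<close> and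
  hence also at distance exactly \<open>d\<close>, so that \<open>y \<mapsto> (x - y) / d\<close> would map this segment onto a
  non-degenerate segment in the unit sphere.\<close>

text \<open>The library's \<open>frontier_cball\<close> requires the type class \<open>perfect_space\<close>, which an arbitrary
  normed space need not satisfy (it may be trivial).\<close>

lemma unit_in_frontier_cball:
  fixes z :: "'a::real_normed_vector"
  assumes "norm z = 1"
  shows "z \<in> frontier (cball 0 1)"
proof -
  have "z \<notin> interior (cball 0 1)"
  proof
    assume "z \<in> interior (cball 0 1)"
    then obtain e where e: "e > 0" "cball z e \<subseteq> cball 0 1"
      by (auto simp: mem_interior_cball)
    \<comment> \<open>Pushing \<open>z\<close> outward along its own ray moves it by exactly
      \<open>e\<close>, as \<open>norm z = 1\<close>, yet raises its norm to
      \<open>1 + e\<close>.\<close>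
    have "z + e *\<^sub>R z \<in> cball z e"
      using e assms by (simp add: dist_norm)
    then have "norm ((1 + e) *\<^sub>R z) \<le> 1"
      using e by (auto simp: scaleR_add_left)
    then show False
      using e assms by simp
  qed
  then show ?thesis
    using assms by (simp add: frontier_def)
qed

text \<open>An attained infimum is a minimum. Conversely, the distances are bounded below by 0, so
  their real infimum is a genuine lower bound.\<close>

lemma is_metric_projection_iff:
  fixes K :: "'a::real_normed_vector set"
  shows "is_metric_projection K x p \<longleftrightarrow> p \<in> K \<and> (\<forall>y\<in>K. norm (x - p) \<le> norm (x - y))"
proof -
  have bdd: "bdd_below ((\<lambda>y. norm (x - y)) ` K)"
    by (rule bdd_belowI2[of _ 0]) simp
  have "norm (x - p) = (INF y\<in>K. norm (x - y))"
    if "p \<in> K" "\<forall>y\<in>K. norm (x - p) \<le> norm (x - y)"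
    by (rule cInf_eq_minimum[symmetric]) (use that in auto)
  then show ?thesis
    unfolding is_metric_projection_def using cINF_lower[OF bdd] by auto
qed

lemma metric_projection_exists:
  fixes K :: "'a::real_normed_vector set"
  assumes "compact K" "K \<noteq> {}"
  shows "\<exists>p. is_metric_projection K x p"
proof -
  have "continuous_on K (\<lambda>y. norm (x - y))"
    by (intro continuous_intros)
  then show ?thesis
    using continuous_attains_inf[OF assms] unfolding is_metric_projection_iff by blast
qed

lemma metric_projection_unique:
  fixes K :: "'a::real_normed_vector set"
  assumes "strictly_convex_norm TYPE('a)" "convex K"
    and p: "is_metric_projection K x p" and q: "is_metric_projection K x q"
  shows "p = q"
proof (rule ccontr)
  assume "p \<noteq> q"
  define d where "d = norm (x - p)"
  have pK: "p \<in> K" and qK: "q \<in> K" and le: "\<And>y. y \<in> K \<Longrightarrow> d \<le> norm (x - y)"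
    using p q by (auto simp: is_metric_projection_iff d_def)
  have dq: "norm (x - q) = d"
    using p q by (auto simp: is_metric_projection_iff d_def intro: antisym)
  \<comment> \<open>At distance 0, both \<open>p\<close> and \<open>q\<close> would coincide with
    \<open>x\<close>.\<close>
  have "d \<noteq> 0"
    using \<open>p \<noteq> q\<close> dq by (auto simp: d_def)
  then have "d > 0"
    by (simp add: d_def)
  define f where "f y = (1 / d) *\<^sub>R (x - y)" for y
  have norm_f: "norm (f y) = norm (x - y) / d" for y
    using \<open>d > 0\<close> by (simp add: f_def)
  have "f p \<noteq> f q"
    using \<open>p \<noteq> q\<close> \<open>d > 0\<close> by (simp add: f_def)
  moreover have "closed_segment (f p) (f q) \<subseteq> frontier (cball 0 1)"
  proof
    fix z assume z: "z \<in> closed_segment (f p) (f q)"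
    then obtain t where t: "0 \<le> t" "t \<le> 1" "z = (1 - t) *\<^sub>R f p + t *\<^sub>R f q"
      by (auto simp: closed_segment_def)
    define r where "r = (1 - t) *\<^sub>R p + t *\<^sub>R q"
    have "r \<in> K"
      using \<open>convex K\<close> pK qK t by (simp add: convex_alt r_def)
    have "x - r = (1 - t) *\<^sub>R (x - p) + t *\<^sub>R (x - q)"
      by (simp add: r_def algebra_simps)
    \<comment> \<open>\<open>f\<close> is affine, so it preserves the weights \<open>1 - t\<close>
      and \<open>t\<close>.\<close>
    then have "z = f r"
      by (simp add: t f_def scaleR_add_right mult.commute)
    then have "1 \<le> norm z"
      using le[OF \<open>r \<in> K\<close>] \<open>d > 0\<close> by (simp add: norm_f)
    \<comment> \<open>The upper bound on \<open>norm z\<close> comes from convexity of the unit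
      ball, which contains both endpoints.\<close>
    moreover have "closed_segment (f p) (f q) \<subseteq> cball 0 1"
      using dq \<open>d > 0\<close> by (intro closed_segment_subset) (auto simp: norm_f d_def)
    ultimately have "norm z = 1"
      using z by (auto intro: antisym)
    then show "z \<in> frontier (cball 0 1)"
      by (rule unit_in_frontier_cball)
  qed
  ultimately show False
    using assms(1) unfolding strictly_convex_norm_def by blast
qed

theorem corollary3p1:
  fixes K :: "'a::real_normed_vector set"
  assumes "finite_dimensional TYPE('a)"
    and "strictly_convex_norm TYPE('a)"
    and "convex_body K"
  shows "\<forall>x. \<exists>!p. is_metric_projection K x p"
proof -
  have "compact K" "convex K" "K \<noteq> {}"
    using assms(3) by (auto simp: convex_body_def)
  then show ?thesis
    using metric_projection_exists metric_projection_unique[OF assms(2)] by blast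
qed

end
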